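(* Let $\alpha,\zeta,\delta>0$ and $\gamma\in\mathbb{R}$, and let $X$ be a real random variable following the symmetric K-distribution with density $$f(x)=\frac{\delta^{\frac{\alpha+\zeta}{2}}}{\Gamma(\alpha)\Gamma(\zeta)}\,|x-\gamma|^{\frac{\alpha+\zeta}{2}-1}K_{\alpha-\zeta}\left(2\sqrt{\delta|x-\gamma|}\right).$$ Then for every integer $n\ge 1$ the $n$-th moment $\mu_n=\int_{-\infty}^{\infty}x^n f(x)\,dx$ is $$\mu_n=\sum_{\substack{0\le k\le n\\ n-k\ \text{even}}}\frac{n\,\gamma^{k}\,(\alpha)_{n-k}\,(\zeta)_{n-k}}{\delta^{n-k}\,\Gamma(k+1)\,(n)_{1-k}} .$$
   Context: $\Gamma$ is the Gamma function; $K_\nu$ is the modified Bessel function of the second kind of order $\nu$. $(a)_j=\Gamma(a+j)/\Gamma(a)$ is the Pochhammer symbol, defined by this ratio also for negative integers $j$; in particular $(n)_{1-k}=\Gamma(n+1-k)/\Gamma(n)$. The convention $\gamma^0=1$ is used, also for $\gamma=0$. *)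

theory Defs
  imports "HOL-Probability.Probability"
begin

(* The modified Bessel function of the second kind of real order nu, defined for x > 0
   (there the integral converges absolutely). For x <= 0 the integral diverges and the value
   is the junk value 0; the density below evaluates it there only at the single point
   x = gamma. *)
definition bessel_K :: "real \<Rightarrow> real \<Rightarrow> real" where
  "bessel_K \<nu> x = (LBINT t:{0..}. exp (- x * cosh t) * cosh (\<nu> * t))"

(* Unlike the library's pochhammer, the index may be negative. *)
definition pochhammer_int :: "real \<Rightarrow> int \<Rightarrow> real" where
  "pochhammer_int a j = Gamma (a + of_int j) / Gamma a"

definition symmetric_K_density :: "real \<Rightarrow> real \<Rightarrow> real \<Rightarrow> real \<Rightarrow> real \<Rightarrow> real" where
  "symmetric_K_density \<alpha> \<zeta> \<delta> \<gamma> x =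
     \<delta> powr ((\<alpha> + \<zeta>) / 2) / (Gamma \<alpha> * Gamma \<zeta>)
       * \<bar>x - \<gamma>\<bar> powr ((\<alpha> + \<zeta>) / 2 - 1)
       * bessel_K (\<alpha> - \<zeta>) (2 * sqrt (\<delta> * \<bar>x - \<gamma>\<bar>))"

end

theory Submission imports Defs begin

text \<open>Expanding \<open>x ^ n\<close> binomially around \<gamma> reduces the claim to central
  moments. The density depends only on the distance to \<gamma>, so odd central moments vanish and
  even ones are twice an integral over the half-line with \<gamma> = 0
  (\<open>has_bochner_integral_central_moment_symmetric_K\<close>).

  That half-line integral is a Mellin transform of the Bessel function:
  \<open>nn_integral_powr_bessel_K\<close> says that y^((a+b)/2-1) * 2 K_{a-b}(2 sqrt y) integrates
  over y > 0 to Gamma a * Gamma b. Multiplying by y^m raises (a+b)/2 by m and leaves a-b alone, so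
  it amounts to replacing (\<alpha>, \<zeta>) by (\<alpha> + m, \<zeta> + m); dividing by Gamma
  \<alpha> * Gamma \<zeta> gives the Pochhammer factors, and the scaling y = \<delta> x gives the
  power of \<delta>. In probabilistic terms, \<delta> times the distance of X from \<gamma> is
  distributed like a product of two independent Gamma variables.

  The Mellin formula comes from writing both Gamma integrals in logarithmic coordinates
  (\<open>nn_integral_exp_Gamma\<close>) and integrating first along the lines where the sum of the
  coordinates is constant: this inner integral is the Bessel function, written as an integral over
  the whole line. Integrals of nonnegative functions are used up to this point, so interchanging
  them is free and the finite value later yields integrability. Finally,
  \<open>binomial_eq_pochhammer_int\<close> identifies the coefficients in the stated sum as
  binomial coefficients.\<close>

section \<open>Exponential substitution and the Gamma integral\<close>

lemma nn_integral_exp_substitution: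
  fixes f :: "real \<Rightarrow> ennreal"
  assumes [measurable]: "f \<in> borel_measurable borel"
  shows "(\<integral>\<^sup>+x. f x * indicator {0<..} x \<partial>lborel) = (\<integral>\<^sup>+q. f (exp q) * ennreal (exp q) \<partial>lborel)"
proof -
  \<comment> \<open>Substitution on compact intervals, then monotone convergence on both sides. The
    margin 1 makes the interval nondegenerate already for n = 0.\<close>
  let ?L = "\<lambda>n::nat. \<lambda>x. f x * indicator {exp (- real n - 1)..exp (real n + 1)} x"
  let ?R = "\<lambda>n::nat. \<lambda>q. f (exp q) * ennreal (exp q) * indicator {- real n - 1..real n + 1} q"
  have eq: "integral\<^sup>N lborel (?L n) = integral\<^sup>N lborel (?R n)" for n
    by (rule nn_integral_substitution_aux)
       (auto intro!: derivative_eq_intros continuous_intros)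
  have ind: "(\<lambda>n. g x * indicator (A n) x) \<longlonglongrightarrow> g x * indicator B x"
    if "\<forall>\<^sub>F n in sequentially. x \<in> A n \<longleftrightarrow> x \<in> B"
    for g :: "real \<Rightarrow> ennreal" and A :: "nat \<Rightarrow> real set" and B x
    by (rule tendsto_eventually, rule eventually_mono[OF that]) (auto simp: indicator_def)
  have "(\<lambda>n. integral\<^sup>N lborel (?L n)) \<longlonglongrightarrow> (\<integral>\<^sup>+x. f x * indicator {0<..} x \<partial>lborel)"
  proof (rule nn_integral_LIMSEQ)
    show "incseq ?L"
      by (auto simp: incseq_def le_fun_def intro!: mult_left_mono split: split_indicator)
        (meson diff_right_mono exp_le_cancel_iff neg_le_iff_le of_nat_mono order_trans,
          meson add_right_mono exp_le_cancel_iff of_nat_mono order_trans)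
    show "(\<lambda>n. ?L n x) \<longlonglongrightarrow> f x * indicator {0<..} x" for x
    proof (rule ind, cases "x > 0")
      case True
      obtain N where N: "\<bar>ln x\<bar> \<le> real N" using real_arch_simple by blast
      have "exp (- real n - 1) \<le> x \<and> x \<le> exp (real n + 1)" if "n \<ge> N" for n
        using N that True by (auto simp: ln_ge_iff[symmetric] ln_le_cancel_iff[of x "exp _", symmetric] simp del: ln_le_cancel_iff)
      then show "\<forall>\<^sub>F n in sequentially. x \<in> {exp (- real n - 1)..exp (real n + 1)} \<longleftrightarrow> x \<in> {0<..}"
        using True by (auto simp: eventually_sequentially)
    next
      case False
      then have "\<not> exp c \<le> x" for c using exp_gt_zero[of c] by linarith
      with False show "\<forall>\<^sub>F n in sequentially. x \<in> {exp (- real n - 1)..exp (real n + 1)} \<longleftrightarrow> x \<in> {0<..}"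
        by auto
    qed
  qed simp
  moreover have "(\<lambda>n. integral\<^sup>N lborel (?R n)) \<longlonglongrightarrow>
      (\<integral>\<^sup>+q. f (exp q) * ennreal (exp q) * indicator UNIV q \<partial>lborel)"
  proof (rule nn_integral_LIMSEQ)
    show "incseq ?R"
      by (auto simp: incseq_def le_fun_def intro!: mult_left_mono split: split_indicator)
    show "(\<lambda>n. ?R n x) \<longlonglongrightarrow> f (exp x) * ennreal (exp x) * indicator UNIV x" for x
    proof (rule ind)
      obtain N where N: "\<bar>x\<bar> \<le> real N" using real_arch_simple by blast
      have "x \<in> {- real n - 1..real n + 1}" if "n \<ge> N" for n
        using N that by auto
      then show "\<forall>\<^sub>F n in sequentially. x \<in> {- real n - 1..real n + 1} \<longleftrightarrow> x \<in> UNIV"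
        by (auto simp: eventually_sequentially)
    qed
  qed simp
  ultimately show ?thesis
    by (simp add: eq LIMSEQ_unique)
qed

lemma nn_integral_exp_Gamma:
  fixes s c :: real
  assumes "s > 0" "c > 0"
  shows "(\<integral>\<^sup>+q. ennreal (exp (s * q - c * exp q)) \<partial>lborel) = ennreal (Gamma s / c powr s)"
proof -
  have "ennreal (Gamma s) = (\<integral>\<^sup>+t. ennreal (t powr (s - 1) / exp t) * indicator {0<..} t \<partial>lborel)"
    unfolding Gamma_conv_nn_integral_real[OF assms(1)]
    by (intro nn_integral_cong) (auto simp: indicator_def)
  also have "\<dots> = (\<integral>\<^sup>+q. ennreal (exp q powr (s - 1) / exp (exp q)) * ennreal (exp q) \<partial>lborel)"
    by (rule nn_integral_exp_substitution) simp
  also have "\<dots> = (\<integral>\<^sup>+q. ennreal (exp (s * q - exp q)) \<partial>lborel)"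
    by (intro nn_integral_cong)
       (simp add: powr_def ennreal_mult[symmetric] exp_diff[symmetric] exp_add[symmetric] algebra_simps)
  \<comment> \<open>Translating q by \<open>ln c\<close> turns \<open>exp q\<close> into
    \<open>c * exp q\<close> and produces the factor \<open>c powr s\<close>.\<close>
  also have "\<dots> = (\<integral>\<^sup>+q. ennreal (exp (s * (ln c + 1 * q) - exp (ln c + 1 * q))) \<partial>lborel)"
    by (subst nn_integral_real_affine[where c = 1 and t = "ln c"]) auto
  also have "\<dots> = (\<integral>\<^sup>+q. ennreal (c powr s) * ennreal (exp (s * q - c * exp q)) \<partial>lborel)"
  proof (intro nn_integral_cong)
    fix q :: real
    have "exp (ln c + 1 * q) = c * exp q"
      using assms(2) by (simp add: exp_add)
    then show "ennreal (exp (s * (ln c + 1 * q) - exp (ln c + 1 * q)))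
      = ennreal (c powr s) * ennreal (exp (s * q - c * exp q))"
      using assms(2) by (simp add: powr_def ennreal_mult[symmetric] exp_add[symmetric] algebra_simps)
  qed
  also have "\<dots> = ennreal (c powr s) * (\<integral>\<^sup>+q. ennreal (exp (s * q - c * exp q)) \<partial>lborel)"
    by (rule nn_integral_cmult) simp
  finally have "ennreal (Gamma s) / ennreal (c powr s) = (\<integral>\<^sup>+q. ennreal (exp (s * q - c * exp q)) \<partial>lborel)"
    using assms(2) by (simp add: ennreal_mult_divide_eq mult.commute[of "ennreal (c powr s)"])
  then show ?thesis
    using assms by (simp add: divide_ennreal Gamma_real_pos less_imp_le)
qed

section \<open>The Bessel function as an integral over the whole line\<close>

lemma integrable_exp_cosh:
  fixes \<nu> x :: real
  assumes "x > 0"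
  shows "integrable lborel (\<lambda>t. exp (\<nu> * t) * exp (- x * cosh t))"
proof -
  \<comment> \<open>A Gamma integrand in logarithmic coordinates. The rate x / 2 comes from 2 cosh t
    >= exp |t|; the added 1 keeps the Gamma parameter positive when \<nu> = 0. Since
    \<open>?G\<close> decays fast only to the right, its reflection is added to dominate on both
    sides.\<close>
  let ?G = "\<lambda>t. exp ((\<bar>\<nu>\<bar> + 1) * t - (x / 2) * exp t)"
  have G: "integrable lborel ?G"
    using assms nn_integral_exp_Gamma[of "\<bar>\<nu>\<bar> + 1" "x / 2"]
    by (intro integrableI_bounded) auto
  have "integrable lborel (\<lambda>t. ?G t + ?G (0 + (-1) * t))"
    by (intro Bochner_Integration.integrable_add G lborel_integrable_real_affine[OF G]) simp
  then show ?thesis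
  proof (rule Bochner_Integration.integrable_bound, goal_cases)
    case 2
    have "exp (\<nu> * t) * exp (- x * cosh t) \<le> ?G \<bar>t\<bar>" for t
    proof -
      have "\<nu> * t \<le> \<bar>\<nu>\<bar> * \<bar>t\<bar>"
        unfolding abs_mult[symmetric] by (rule abs_ge_self)
      then have "\<nu> * t \<le> (\<bar>\<nu>\<bar> + 1) * \<bar>t\<bar>"
        unfolding distrib_right by simp
      moreover have "exp \<bar>t\<bar> \<le> 2 * cosh t"
        by (cases "t \<ge> 0") (auto simp: cosh_field_def)
      then have "x / 2 * exp \<bar>t\<bar> \<le> x * cosh t"
        using assms by (simp add: field_simps)
      ultimately show ?thesis
        by (simp add: exp_add[symmetric])
    qed
    moreover have "?G \<bar>t\<bar> \<le> ?G t + ?G (0 + (-1) * t)" for t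
      by (cases "t \<ge> 0") simp_all
    ultimately have "exp (\<nu> * t) * exp (- x * cosh t) \<le> ?G t + ?G (0 + (-1) * t)" for t
      by (meson order_trans)
    then show ?case
      by (intro AE_I2) (simp only: real_norm_def abs_of_nonneg add_nonneg_nonneg mult_nonneg_nonneg exp_ge_zero)
  qed (simp add: cosh_field_def)
qed

lemma bessel_K_eq_integral_UNIV:
  fixes \<nu> x :: real
  assumes "x > 0"
  shows "2 * bessel_K \<nu> x = (LBINT t. exp (\<nu> * t) * exp (- x * cosh t))"
proof -
  let ?F = "\<lambda>t. exp (\<nu> * t) * exp (- x * cosh t)"
  let ?H = "\<lambda>t. exp (- x * cosh t) * cosh (\<nu> * t)"
  have F: "has_bochner_integral lborel ?F (integral\<^sup>L lborel ?F)"
    using integrable_exp_cosh[OF assms] by (rule has_bochner_integral_integrable)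
  have F': "has_bochner_integral lborel (\<lambda>t. ?F (0 + (-1) * t)) (integral\<^sup>L lborel ?F)"
    using lborel_has_bochner_integral_real_affine_iff[of "-1" ?F _ 0] F by simp
  \<comment> \<open>Averaging with the reflection replaces \<open>exp (\<nu> * t)\<close> by
    \<open>cosh (\<nu> * t)\<close> without changing the integral; the result is even, so its
    integral is twice that over the half-line.\<close>
  have "has_bochner_integral lborel (\<lambda>t. (?F t + ?F (0 + (-1) * t)) / 2)
      ((integral\<^sup>L lborel ?F + integral\<^sup>L lborel ?F) / 2)"
    by (intro has_bochner_integral_divide_zero has_bochner_integral_add F F')
  also have "(\<lambda>t. (?F t + ?F (0 + (-1) * t)) / 2) = ?H"
    unfolding cosh_field_def[of "\<nu> * t" for t] by (simp add: fun_eq_iff field_simps)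
  finally have H: "has_bochner_integral lborel ?H (integral\<^sup>L lborel ?F)"
    by simp
  have "integrable lborel (\<lambda>t. indicator {0..} t *\<^sub>R ?H t)"
    using H by (intro integrable_mult_indicator) (auto simp: has_bochner_integral_iff)
  then have "has_bochner_integral lborel (\<lambda>t. indicator {0..} t *\<^sub>R ?H t) (bessel_K \<nu> x)"
    unfolding bessel_K_def set_lebesgue_integral_def by (rule has_bochner_integral_integrable)
  then have "has_bochner_integral lborel ?H (2 * bessel_K \<nu> x)"
    using has_bochner_integral_even_function[of ?H] by simp
  with H show ?thesis
    using has_bochner_integral_eq by blast
qed

lemma bessel_K_nonneg: "bessel_K \<nu> x \<ge> 0"
  unfolding bessel_K_def set_lebesgue_integral_def
  by (intro integral_nonneg_AE AE_I2) simp

lemma borel_measurable_bessel_K [measurable]: "bessel_K \<nu> \<in> borel_measurable borel"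
  unfolding bessel_K_def set_lebesgue_integral_def cosh_field_def by measurable

section \<open>The Mellin transform of the Bessel function\<close>

lemma nn_integral_bessel_K:
  fixes \<nu> x :: real
  assumes "x > 0"
  shows "(\<integral>\<^sup>+t. ennreal (exp (\<nu> * t) * exp (- x * cosh t)) \<partial>lborel) = ennreal (2 * bessel_K \<nu> x)"
  using integrable_exp_cosh[OF assms, of \<nu>]
  by (simp add: nn_integral_eq_integral bessel_K_eq_integral_UNIV[OF assms])

text \<open>Taking logarithmic coordinates in both Gamma integrals, the substitution
  \<open>(s, r) = (q/2 + t, q/2 - t)\<close> has Jacobian determinant 1 and splits off the Bessel integral.\<close>

lemma nn_integral_powr_bessel_K:
  fixes a b :: real
  assumes "a > 0" "b > 0"
  shows "(\<integral>\<^sup>+y. ennreal (y powr ((a + b) / 2 - 1) * (2 * bessel_K (a - b) (2 * sqrt y))) * indicator {0<..} y \<partial>lborel)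
    = ennreal (Gamma a * Gamma b)"
proof -
  let ?F = "\<lambda>s r. ennreal (exp (a * s - exp s)) * ennreal (exp (b * r - exp r))"
  have "(\<integral>\<^sup>+y. ennreal (y powr ((a + b) / 2 - 1) * (2 * bessel_K (a - b) (2 * sqrt y))) * indicator {0<..} y \<partial>lborel)
    = (\<integral>\<^sup>+q. ennreal (exp q powr ((a + b) / 2 - 1) * (2 * bessel_K (a - b) (2 * sqrt (exp q)))) * ennreal (exp q) \<partial>lborel)"
    by (rule nn_integral_exp_substitution) measurable
  also have "\<dots> = (\<integral>\<^sup>+q. ennreal (exp ((a + b) / 2 * q)) * ennreal (2 * bessel_K (a - b) (2 * exp (q / 2))) \<partial>lborel)"
  proof (intro nn_integral_cong)
    fix q :: real
    have "sqrt (exp q) = exp (q / 2)"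
      by (rule real_sqrt_unique) (auto simp: power2_eq_square exp_add[symmetric])
    moreover have "exp q powr ((a + b) / 2 - 1) * exp q = exp ((a + b) / 2 * q)"
      by (simp add: powr_def exp_add[symmetric] algebra_simps)
    moreover have "ennreal (P * (2 * K)) * ennreal E = ennreal (P * E) * ennreal (2 * K)"
      if "P \<ge> 0" "K \<ge> 0" "E \<ge> 0" for P K E :: real
      using that by (simp add: ennreal_mult mult_ac)
    ultimately show "ennreal (exp q powr ((a + b) / 2 - 1) * (2 * bessel_K (a - b) (2 * sqrt (exp q)))) * ennreal (exp q)
      = ennreal (exp ((a + b) / 2 * q)) * ennreal (2 * bessel_K (a - b) (2 * exp (q / 2)))"
      by (simp only: bessel_K_nonneg powr_ge_zero exp_ge_zero)
  qed
  also have "\<dots> = (\<integral>\<^sup>+q. (\<integral>\<^sup>+t. ?F (q / 2 + t) (q / 2 - t) \<partial>lborel) \<partial>lborel)"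
  proof (intro nn_integral_cong)
    fix q :: real
    have "ennreal (exp ((a + b) / 2 * q)) * ennreal (2 * bessel_K (a - b) (2 * exp (q / 2)))
      = (\<integral>\<^sup>+t. ennreal (exp ((a + b) / 2 * q)) * ennreal (exp ((a - b) * t) * exp (- (2 * exp (q / 2)) * cosh t)) \<partial>lborel)"
      by (subst nn_integral_bessel_K[symmetric]) (simp_all add: nn_integral_cmult cosh_field_def)
    also have "\<dots> = (\<integral>\<^sup>+t. ?F (q / 2 + t) (q / 2 - t) \<partial>lborel)"
    proof (intro nn_integral_cong)
      fix t :: real
      \<comment> \<open>With s = q/2 + t and r = q/2 - t, the linear part is a s + b r = (a+b)/2 q +
        (a-b) t, and exp s + exp r is the cosh term.\<close>
      have "2 * exp (q / 2) * cosh t = exp (q / 2 + t) + exp (q / 2 - t)"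
        by (simp only: cosh_field_def exp_add exp_diff exp_minus) (simp add: field_simps)
      then have "(a + b) / 2 * q + ((a - b) * t + - (2 * exp (q / 2)) * cosh t)
        = (a * (q / 2 + t) - exp (q / 2 + t)) + (b * (q / 2 - t) - exp (q / 2 - t))"
        by (simp add: field_simps)
      then show "ennreal (exp ((a + b) / 2 * q)) * ennreal (exp ((a - b) * t) * exp (- (2 * exp (q / 2)) * cosh t))
        = ?F (q / 2 + t) (q / 2 - t)"
        by (simp only: ennreal_mult[symmetric] exp_ge_zero exp_add[symmetric])
    qed
    finally show "ennreal (exp ((a + b) / 2 * q)) * ennreal (2 * bessel_K (a - b) (2 * exp (q / 2)))
      = (\<integral>\<^sup>+t. ?F (q / 2 + t) (q / 2 - t) \<partial>lborel)" .
  qed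
  \<comment> \<open>The planar change of variables is done one coordinate at a time: r = q/2 - t for
    fixed q, then, after exchanging the integrals, s = q - r for fixed r. Each is a shift or a
    reflected shift, so no Jacobian factor appears.\<close>
  also have "\<dots> = (\<integral>\<^sup>+q. (\<integral>\<^sup>+r. ?F (q - r) r \<partial>lborel) \<partial>lborel)"
  proof (rule nn_integral_cong)
    fix q :: real
    show "(\<integral>\<^sup>+t. ?F (q / 2 + t) (q / 2 - t) \<partial>lborel) = (\<integral>\<^sup>+r. ?F (q - r) r \<partial>lborel)"
      by (subst nn_integral_real_affine[where c = "-1" and t = "q / 2"]) (auto simp: algebra_simps)
  qed
  also have "\<dots> = (\<integral>\<^sup>+r. (\<integral>\<^sup>+q. ?F (q - r) r \<partial>lborel) \<partial>lborel)"
    by (rule lborel_pair.Fubini') measurable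
  also have "\<dots> = (\<integral>\<^sup>+r. (\<integral>\<^sup>+s. ?F s r \<partial>lborel) \<partial>lborel)"
  proof (rule nn_integral_cong)
    fix r :: real
    show "(\<integral>\<^sup>+q. ?F (q - r) r \<partial>lborel) = (\<integral>\<^sup>+s. ?F s r \<partial>lborel)"
      by (subst nn_integral_real_affine[where c = 1 and t = r]) (auto simp: algebra_simps)
  qed
  also have "\<dots> = (\<integral>\<^sup>+s. ennreal (exp (a * s - exp s)) \<partial>lborel) * (\<integral>\<^sup>+r. ennreal (exp (b * r - exp r)) \<partial>lborel)"
    by (simp add: nn_integral_multc nn_integral_cmult)
  also have "\<dots> = ennreal (Gamma a * Gamma b)"
    using nn_integral_exp_Gamma[of a 1] nn_integral_exp_Gamma[of b 1] assms
    by (simp add: ennreal_mult Gamma_real_pos less_imp_le)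
  finally show ?thesis .
qed

section \<open>Moments of the density about its centre\<close>

lemma symmetric_K_density_nonneg:
  assumes "\<alpha> > 0" "\<zeta> > 0"
  shows "symmetric_K_density \<alpha> \<zeta> \<delta> \<gamma> x \<ge> 0"
  unfolding symmetric_K_density_def
  by (intro mult_nonneg_nonneg divide_nonneg_nonneg bessel_K_nonneg)
    (auto simp: Gamma_real_pos assms less_imp_le)

lemma borel_measurable_symmetric_K_density [measurable]:
  "symmetric_K_density \<alpha> \<zeta> \<delta> \<gamma> \<in> borel_measurable borel"
  unfolding symmetric_K_density_def by measurable

text \<open>The Mellin formula at a = \<alpha> + m, b = \<zeta> + m after rescaling y = \<delta> x.
  The final factor 1/2 reflects that only one side of the symmetric density is integrated.\<close>

lemma has_bochner_integral_half_moment_symmetric_K: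
  fixes \<alpha> \<zeta> \<delta> :: real
  assumes "\<alpha> > 0" "\<zeta> > 0" "\<delta> > 0"
  shows "has_bochner_integral lborel (\<lambda>x. indicator {0..} x *\<^sub>R (x ^ m * symmetric_K_density \<alpha> \<zeta> \<delta> 0 x))
    (pochhammer_int \<alpha> (int m) * pochhammer_int \<zeta> (int m) / \<delta> ^ m / 2)"
proof (rule has_bochner_integral_nn_integral)
  define a b e where "a = \<alpha> + real m" and "b = \<zeta> + real m" and "e = (\<alpha> + \<zeta>) / 2"
  define C where "C = \<delta> powr e / (Gamma \<alpha> * Gamma \<zeta>)"
  \<comment> \<open>The normalising constant \<open>C\<close>, divided by the power of \<delta> that
    the rescaled integrand carries and by the 2 in front of its Bessel function.\<close>
  define D where "D = C / (2 * \<delta> powr (e + m - 1))"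
  let ?g = "\<lambda>y. ennreal (y powr ((a + b) / 2 - 1) * (2 * bessel_K (a - b) (2 * sqrt y))) * indicator {0<..} y"
  have pos: "a > 0" "b > 0" "Gamma \<alpha> > 0" "Gamma \<zeta> > 0" "Gamma a > 0" "Gamma b > 0"
    using assms by (auto simp: a_def b_def Gamma_real_pos)
  have D: "D \<ge> 0" using assms pos by (auto simp: D_def C_def)
  have "ennreal (Gamma a * Gamma b) = ennreal \<delta> * (\<integral>\<^sup>+x. ?g (0 + \<delta> * x) \<partial>lborel)"
    unfolding nn_integral_powr_bessel_K[OF pos(1,2), symmetric]
    using assms by (subst nn_integral_real_affine[where c = \<delta> and t = 0]) auto
  then have "(\<integral>\<^sup>+x. ?g (0 + \<delta> * x) \<partial>lborel) = ennreal (Gamma a * Gamma b) / ennreal \<delta>"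
    using assms by (simp add: ennreal_mult_divide_eq mult.commute[of "ennreal \<delta>"])
  then have g: "(\<integral>\<^sup>+x. ?g (0 + \<delta> * x) \<partial>lborel) = ennreal (Gamma a * Gamma b / \<delta>)"
    using assms pos by (simp add: divide_ennreal)
  have "(\<integral>\<^sup>+x. ennreal (indicator {0..} x *\<^sub>R (x ^ m * symmetric_K_density \<alpha> \<zeta> \<delta> 0 x)) \<partial>lborel)
    = (\<integral>\<^sup>+x. ennreal D * ?g (0 + \<delta> * x) \<partial>lborel)"
  proof (intro nn_integral_cong)
    fix x :: real
    show "ennreal (indicator {0..} x *\<^sub>R (x ^ m * symmetric_K_density \<alpha> \<zeta> \<delta> 0 x)) = ennreal D * ?g (0 + \<delta> * x)"
    proof (cases "x > 0")
      case True
      have "(\<delta> * x) powr ((a + b) / 2 - 1) = \<delta> powr (e + m - 1) * (x powr (e - 1) * x ^ m)"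
        using True assms
        by (simp add: powr_mult a_def b_def e_def powr_realpow[symmetric] powr_add[symmetric] field_simps)
      then have "D * ((\<delta> * x) powr ((a + b) / 2 - 1) * (2 * bessel_K (a - b) (2 * sqrt (\<delta> * x))))
        = x ^ m * symmetric_K_density \<alpha> \<zeta> \<delta> 0 x"
        using True assms by (simp add: D_def C_def e_def a_def b_def symmetric_K_density_def)
      then show ?thesis
        using True assms D by (simp add: ennreal_mult'[symmetric])
    next
      \<comment> \<open>At x = 0 both sides vanish, because \<open>0 powr _\<close> is 0 in the
        density; hence the closed and the open half-line agree pointwise.\<close>
      case False
      then show ?thesis
        using assms
        by (cases "x = 0") (auto simp: symmetric_K_density_def zero_less_mult_iff)
    qed
  qed
  also have "\<dots> = ennreal (D * (Gamma a * Gamma b / \<delta>))"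
    using D by (subst nn_integral_cmult, measurable) (simp only: g ennreal_mult')
  also have "D * (Gamma a * Gamma b / \<delta>) = pochhammer_int \<alpha> (int m) * pochhammer_int \<zeta> (int m) / \<delta> ^ m / 2"
  proof -
    \<comment> \<open>The Jacobian of the rescaling supplies the missing factor \<delta>;
      \<open>\<delta> powr e\<close> then cancels against \<open>C\<close>, leaving only
      \<open>\<delta> ^ m\<close>.\<close>
    have "\<delta> powr (e + m - 1) * \<delta> = \<delta> powr e * \<delta> ^ m"
      using assms by (simp add: powr_diff powr_add powr_realpow)
    then have "D * (Gamma a * Gamma b / \<delta>) = C * (Gamma a * Gamma b) / (2 * (\<delta> powr e * \<delta> ^ m))"
      by (simp add: D_def)
    also have "\<dots> = pochhammer_int \<alpha> (int m) * pochhammer_int \<zeta> (int m) / \<delta> ^ m / 2"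
      using assms pos by (simp add: C_def pochhammer_int_def a_def b_def)
    finally show ?thesis .
  qed
  finally show "(\<integral>\<^sup>+x. ennreal (indicator {0..} x *\<^sub>R (x ^ m * symmetric_K_density \<alpha> \<zeta> \<delta> 0 x)) \<partial>lborel)
    = ennreal (pochhammer_int \<alpha> (int m) * pochhammer_int \<zeta> (int m) / \<delta> ^ m / 2)" .
  show "0 \<le> pochhammer_int \<alpha> (int m) * pochhammer_int \<zeta> (int m) / \<delta> ^ m / 2"
    using assms by (simp add: pochhammer_int_def Gamma_real_pos less_imp_le add_pos_nonneg)
  show "AE x in lborel. 0 \<le> indicator {0..} x *\<^sub>R (x ^ m * symmetric_K_density \<alpha> \<zeta> \<delta> 0 x)"
    using symmetric_K_density_nonneg[OF assms(1,2)] by (intro AE_I2) (simp split: split_indicator)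
qed measurable

lemma has_bochner_integral_central_moment_symmetric_K:
  fixes \<alpha> \<zeta> \<delta> \<gamma> :: real
  assumes "\<alpha> > 0" "\<zeta> > 0" "\<delta> > 0"
  shows "has_bochner_integral lborel (\<lambda>x. (x - \<gamma>) ^ m * symmetric_K_density \<alpha> \<zeta> \<delta> \<gamma> x)
    (if even m then pochhammer_int \<alpha> (int m) * pochhammer_int \<zeta> (int m) / \<delta> ^ m else 0)"
proof -
  let ?f = "\<lambda>x. x ^ m * symmetric_K_density \<alpha> \<zeta> \<delta> 0 x"
  let ?v = "if even m then pochhammer_int \<alpha> (int m) * pochhammer_int \<zeta> (int m) / \<delta> ^ m else 0"
  note half = has_bochner_integral_half_moment_symmetric_K[OF assms, of m]
  have "has_bochner_integral lborel ?f ?v"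
  proof (cases "even m")
    case True
    then show ?thesis
      using has_bochner_integral_even_function[OF half] by (simp add: symmetric_K_density_def)
  next
    case False
    then show ?thesis
      using has_bochner_integral_odd_function[OF half] by (simp add: symmetric_K_density_def)
  qed
  \<comment> \<open>Translation carries the centred case to arbitrary \<gamma>.\<close>
  then have "has_bochner_integral lborel (\<lambda>x. ?f (- \<gamma> + 1 * x)) ?v"
    using lborel_has_bochner_integral_real_affine_iff[of 1 ?f ?v "- \<gamma>"] by simp
  then show ?thesis
    by (simp add: symmetric_K_density_def)
qed

section \<open>Binomial coefficients and the final sum\<close>

text \<open>For k <= n and n >= 1 all Gamma arguments are positive integers, so (n)_{1-k} = (n-k)! /
  (n-1)!, and n (n-1)! = n! does the rest.\<close>

lemma binomial_eq_pochhammer_int: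
  assumes "n \<ge> 1" "k \<le> n"
  shows "real (n choose k) = real n / (Gamma (real k + 1) * pochhammer_int (real n) (1 - int k))"
proof -
  have "Gamma (real k + 1) = fact k"
    by (simp add: Gamma_fact add.commute)
  moreover have "Gamma (real n + of_int (1 - int k)) = fact (n - k)"
    using assms Gamma_fact[of "n - k", where 'a = real] by (simp add: of_nat_diff algebra_simps)
  moreover have "Gamma (real n) = fact (n - 1)"
    using assms Gamma_fact[of "n - 1", where 'a = real] by (simp add: of_nat_diff)
  moreover have "(fact n :: real) = real n * fact (n - 1)"
    using assms by (simp add: fact_reduce)
  ultimately show ?thesis
    by (simp add: pochhammer_int_def binomial_fact[OF assms(2)])
qed

theorem mainTheorem3:
  fixes \<alpha> \<zeta> \<delta> \<gamma> :: real and M :: "'a measure" and X :: "'a \<Rightarrow> real" and n :: nat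
  assumes "\<alpha> > 0" and "\<zeta> > 0" and "\<delta> > 0"
    and "prob_space M"
    and "distributed M lborel X (\<lambda>x. ennreal (symmetric_K_density \<alpha> \<zeta> \<delta> \<gamma> x))"
    and "n \<ge> 1"
  shows "integrable lborel (\<lambda>x. x ^ n * symmetric_K_density \<alpha> \<zeta> \<delta> \<gamma> x)
    \<and> prob_space.expectation M (\<lambda>\<omega>. X \<omega> ^ n)
        = (LBINT x. x ^ n * symmetric_K_density \<alpha> \<zeta> \<delta> \<gamma> x)
    \<and> (LBINT x. x ^ n * symmetric_K_density \<alpha> \<zeta> \<delta> \<gamma> x)
        = (\<Sum>k | k \<le> n \<and> even (n - k).
             real n * \<gamma> ^ k * pochhammer_int \<alpha> (int (n - k)) * pochhammer_int \<zeta> (int (n - k))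
             / (\<delta> ^ (n - k) * Gamma (real k + 1) * pochhammer_int (real n) (1 - int k)))"
proof -
  let ?f = "symmetric_K_density \<alpha> \<zeta> \<delta> \<gamma>"
  let ?P = "\<lambda>m. pochhammer_int \<alpha> (int m) * pochhammer_int \<zeta> (int m) / \<delta> ^ m"
  let ?S = "\<Sum>k\<le>n. real (n choose k) * \<gamma> ^ k * (if even (n - k) then ?P (n - k) else 0)"
  \<comment> \<open>The binomial expansion of x = \<gamma> + (x - \<gamma>), integrated term by
    term; this also gives integrability of the n-th moment.\<close>
  have "has_bochner_integral lborel
      (\<lambda>x. \<Sum>k\<le>n. real (n choose k) * \<gamma> ^ k * ((x - \<gamma>) ^ (n - k) * ?f x)) ?S"
    by (intro has_bochner_integral_sum has_bochner_integral_mult_right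
          has_bochner_integral_central_moment_symmetric_K assms)
  moreover have "(\<Sum>k\<le>n. real (n choose k) * \<gamma> ^ k * ((x - \<gamma>) ^ (n - k) * ?f x)) = x ^ n * ?f x" for x
    using binomial_ring[of \<gamma> "x - \<gamma>" n] by (simp add: sum_distrib_right mult.assoc)
  ultimately have moment: "has_bochner_integral lborel (\<lambda>x. x ^ n * ?f x) ?S"
    by simp
  have "?S = (\<Sum>k\<in>{k \<in> {..n}. even (n - k)}. real (n choose k) * \<gamma> ^ k * ?P (n - k))"
    by (subst sum.inter_filter) (auto intro!: sum.cong)
  also have "\<dots> = (\<Sum>k | k \<le> n \<and> even (n - k).
      real n * \<gamma> ^ k * pochhammer_int \<alpha> (int (n - k)) * pochhammer_int \<zeta> (int (n - k))
      / (\<delta> ^ (n - k) * Gamma (real k + 1) * pochhammer_int (real n) (1 - int k)))"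
    by (rule sum.cong) (auto simp: binomial_eq_pochhammer_int[OF assms(6)] mult_ac)
  finally have S: "?S = \<dots>" .
  \<comment> \<open>Change of variables along the law of \<open>X\<close>, which links the
    expectation to the integral against the density.\<close>
  have "(LBINT x. ?f x * x ^ n) = prob_space.expectation M (\<lambda>\<omega>. X \<omega> ^ n)"
    by (rule distributed_integral[OF assms(5)]) (auto simp: symmetric_K_density_nonneg assms)
  then have "prob_space.expectation M (\<lambda>\<omega>. X \<omega> ^ n) = (LBINT x. x ^ n * ?f x)"
    by (simp add: mult.commute)
  then show ?thesis
    using moment S by (simp add: has_bochner_integral_iff)
qed

end
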